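(* Let $(z^j)_{j\ge 0}$ be generated by the relaxed Peaceman-Rachford iteration with relaxation parameters $(\lambda_j)_{j\ge0}\subset(0,1]$, let $z^\ast$ be a fixed point of $T_{\mathrm{PRS}}$ and $x^\ast=\mathbf{prox}_{\gamma g}(z^\ast)$. Then for all $k\ge 0$, $$8\gamma\lambda_k\big(S_f(x_f^k,x^\ast)+S_g(x_g^k,x^\ast)\big)\le \|z^k-z^\ast\|^2-\|z^{k+1}-z^\ast\|^2+\Big(1-\frac1{\lambda_k}\Big)\|z^{k+1}-z^k\|^2 .$$ Therefore $8\gamma\sum_{i=0}^\infty\lambda_i\big(S_f(x_f^i,x^\ast)+S_g(x_g^i,x^\ast)\big)\le\|z^0-z^\ast\|^2$, and: 1. (Best iterate convergence) If $\inf_{j\ge0}\lambda_j>0$, then $\min_{i=0,\dots,k}S_f(x_f^i,x^\ast)=o(1/(k+1))$ and $\min_{i=0,\dots,k}S_g(x_g^i,x^\ast)=o(1/(k+1))$ as $k\to\infty$. 2. (Ergodic convergence) Let $\Lambda_k=\sum_{i=0}^k\lambda_i$, $\overline x_f^k=\frac1{\Lambda_k}\sum_{i=0}^k\lambda_ix_f^i$ and $\overline x_g^k=\frac1{\Lambda_k}\sum_{i=0}^k\lambda_ix_g^i$. Then for all $k\geq 0$ $$\overline S_f(x_f^k,x^\ast)+\overline S_g(x_g^k,x^\ast)\le\frac{\|z^0-z^\ast\|^2}{8\gamma\Lambda_k},$$ where $\overline S_f(x_f^k,x^\ast):=\max\Big\{\frac{\mu_f}2\|\overline x_f^k-x^\ast\|^2,\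 \frac{\beta_f}2\Big\|\frac1{\Lambda_k}\sum_{i=0}^k\lambda_i\widetilde\nabla f(x_f^i)-\widetilde\nabla f(x^\ast)\Big\|^2\Big\}$ and $\overline S_g(x_g^k,x^\ast)$ is defined in the same way with $g$, $x_g$ in place of $f$, $x_f$. 3. (Nonergodic convergence) If $\inf_{j\ge0}\lambda_j(1-\lambda_j)>0$, then $S_f(x_f^k,x^\ast)+S_g(x_g^k,x^\ast)=o(1/\sqrt{k+1})$ as $k\to\infty$.
   Context: $\mathcal H$ is a real Hilbert space; $f,g:\mathcal H\to(-\infty,\infty]$ are closed, proper, convex, and there is $x\in\mathcal H$ with $0\in\partial f(x)+\partial g(x)$. Fix $\gamma>0$. $\mathbf{prox}_{\gamma f}(x)=\arg\min_y f(y)+\frac1{2\gamma}\|y-x\|^2$, $\mathbf{refl}_{\gamma f}=2\,\mathbf{prox}_{\gamma f}-I$, and $T_{\mathrm{PRS}}=\mathbf{refl}_{\gamma f}\circ\mathbf{refl}_{\gamma g}$. Relaxed Peaceman-Rachford iteration: $z^0\in\mathcal H$ arbitrary, $z^{k+1}=(1-\lambda_k)z^k+\lambda_kT_{\mathrm{PRS}}z^k$. Auxiliary points: $x_g^k=\mathbf{prox}_{\gamma g}(z^k)$, $x_f^k=\mathbf{prox}_{\gamma f}(2x_g^k-z^k)$. Selected subgradients: $\widetilde\nabla g(x_g^k)=\frac1\gamma(z^k-x_g^k)\in\partial g(x_g^k)$, $\widetilde\nabla f(x_f^k)=\frac1\gamma(2x_g^k-z^k-x_f^k)\in\partial f(x_f^k)$,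 $\widetilde\nabla g(x^\ast)=\frac1\gamma(z^\ast-x^\ast)\in\partial g(x^\ast)$, $\widetilde\nabla f(x^\ast)=-\frac1\gamma(z^\ast-x^\ast)\in\partial f(x^\ast)$. Regularity constants: $\mu_f,\mu_g,\beta_f,\beta_g\ge0$ are such that $f$ is $\mu_f$-strongly convex and $g$ is $\mu_g$-strongly convex ($\mu=0$ means no strong convexity is assumed), and if $\beta_f>0$ (resp. $\beta_g>0$) then $f$ (resp. $g$) is Fréchet differentiable on $\mathcal H$ with $(1/\beta_f)$- (resp. $(1/\beta_g)$-) Lipschitz gradient ($\beta=0$ means no differentiability is assumed). For $h\in\{f,g\}$, $$S_h(x,y)=\max\Big\{\frac{\mu_h}2\|x-y\|^2,\ \frac{\beta_h}2\|\widetilde\nabla h(x)-\widetilde\nabla h(y)\|^2\Big\},$$ evaluated with the selected subgradients above. *)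

theory Defs
  imports "HOL-Analysis.Analysis" "HOL-Library.Set_Algebras" "HOL-Library.Landau_Symbols"
begin

definition epi :: "('a \<Rightarrow> ereal) \<Rightarrow> ('a \<times> real) set" where
  "epi f = {(x, r). f x \<le> ereal r}"

definition proper :: "('a \<Rightarrow> ereal) \<Rightarrow> bool" where
  "proper f \<longleftrightarrow> (\<forall>x. f x \<noteq> -\<infinity>) \<and> (\<exists>x. f x \<noteq> \<infinity>)"

definition closed_proper_convex :: "('a::real_normed_vector \<Rightarrow> ereal) \<Rightarrow> bool" where
  "closed_proper_convex f \<longleftrightarrow> closed (epi f) \<and> proper f \<and> convex (epi f)"

text \<open>
  Intended for functions that never take the value \<open>-\<infinity>\<close>, so that no sum
  \<open>\<infinity> + (-\<infinity>)\<close> occurs. For \<open>\<mu> = 0\<close> this is ordinary convexity.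
\<close>

definition strongly_convex :: "real \<Rightarrow> ('a::real_normed_vector \<Rightarrow> ereal) \<Rightarrow> bool" where
  "strongly_convex \<mu> f \<longleftrightarrow>
     (\<forall>x y. \<forall>t\<in>{0<..<1}.
        f (t *\<^sub>R x + (1 - t) *\<^sub>R y) + ereal (\<mu> / 2 * t * (1 - t) * (norm (x - y))\<^sup>2)
          \<le> ereal t * f x + ereal (1 - t) * f y)"

text \<open>
  Finiteness is required separately, since \<open>real_of_ereal\<close> maps \<open>\<infinity>\<close> to \<open>0\<close>.
\<close>

definition lipschitz_gradient :: "real \<Rightarrow> ('a::real_inner \<Rightarrow> ereal) \<Rightarrow> bool" where
  "lipschitz_gradient L f \<longleftrightarrow>
     (\<forall>x. \<bar>f x\<bar> \<noteq> \<infinity>) \<and>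
     (\<exists>G. (\<forall>x. GDERIV (\<lambda>y. real_of_ereal (f y)) x :> G x) \<and> L-lipschitz_on UNIV G)"

definition subdifferential :: "('a::real_inner \<Rightarrow> ereal) \<Rightarrow> 'a \<Rightarrow> 'a set" where
  "subdifferential f x = {u. \<forall>y. f x + ereal (u \<bullet> (y - x)) \<le> f y}"

definition prox :: "real \<Rightarrow> ('a::real_normed_vector \<Rightarrow> ereal) \<Rightarrow> 'a \<Rightarrow> 'a" where
  "prox \<gamma> f x = (ARG_MIN (\<lambda>y. f y + ereal (1 / (2 * \<gamma>) * (norm (y - x))\<^sup>2)) y. True)"

definition reflector :: "real \<Rightarrow> ('a::real_normed_vector \<Rightarrow> ereal) \<Rightarrow> 'a \<Rightarrow> 'a" where
  "reflector \<gamma> f x = 2 *\<^sub>R prox \<gamma> f x - x"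

definition T_PRS ::
  "real \<Rightarrow> ('a::real_normed_vector \<Rightarrow> ereal) \<Rightarrow> ('a \<Rightarrow> ereal) \<Rightarrow> 'a \<Rightarrow> 'a" where
  "T_PRS \<gamma> f g = reflector \<gamma> f \<circ> reflector \<gamma> g"

text \<open>
  The subgradients \<open>u\<close> at \<open>x\<close> and \<open>v\<close> at \<open>y\<close> are passed explicitly, because they
  are selected by the algorithm and not determined by the points when the function
  is not differentiable.
\<close>

definition S_reg ::
  "real \<Rightarrow> real \<Rightarrow> 'a::real_normed_vector \<Rightarrow> 'a \<Rightarrow> 'a \<Rightarrow> 'a \<Rightarrow> real" where
  "S_reg \<mu> \<beta> x u y v = max (\<mu> / 2 * (norm (x - y))\<^sup>2) (\<beta> / 2 * (norm (u - v))\<^sup>2)"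

end

theory Submission
  imports Defs
begin

text \<open>Strong convexity and the Baillon-Haddad inequality give
  \<open>2 * S\<^sub>h(x, y) \<le> \<langle>\<nabla>h(x) - \<nabla>h(y), x - y\<rangle>\<close> for \<open>h = f, g\<close>. Adding the two inequalities at the iterates
  and at \<open>x'\<close>, and using \<open>x\<^sub>g - x\<^sub>f = \<gamma> (u\<^sub>f + u\<^sub>g)\<close>, the right-hand sides combine to
  \<open>(\<langle>x\<^sub>g - x\<^sub>f, z - z'\<rangle> - \<parallel>x\<^sub>g - x\<^sub>f\<parallel>\<^sup>2) / \<gamma>\<close>, which up to the factor \<open>4 * \<gamma> * lam k\<close> is exactly the right-hand
  side of the main inequality. Telescoping yields summability, hence the best-iterate rate, and by Jensen
  the ergodic one. When \<open>lam k * (1 - lam k)\<close> is bounded away from zero, \<open>\<parallel>x\<^sub>g - x\<^sub>f\<parallel>\<^sup>2\<close> is summable as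
  well; it is nonincreasing because the operator is nonexpansive, so it is \<open>o(1 / (k + 1))\<close>, and
  Cauchy-Schwarz gives the nonergodic rate.\<close>

text \<open>Serves to let \<open>t\<close> tend to 0 from the right once a convexity inequality
  along a segment has been divided by \<open>t\<close>.\<close>

lemma le_of_le_add_scaled:
  fixes A B C :: real
  assumes "\<And>t. 0 < t \<Longrightarrow> t < 1 \<Longrightarrow> A \<le> C + t * B"
  shows "A \<le> C"
proof (rule tendsto_le[OF trivial_limit_at_right_real _ tendsto_const])
  show "((\<lambda>t. C + t * B) \<longlongrightarrow> C) (at_right 0)"
    by (auto intro!: tendsto_eq_intros)
  show "\<forall>\<^sub>F t in at_right 0. A \<le> C + t * B"
    by (rule eventually_at_rightI[of 0 1]) (use assms in auto)
qed

section \<open>Subgradients\<close>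

lemma subgradient_finite:
  assumes "proper f" "u \<in> subdifferential f x"
  obtains a where "f x = ereal a"
proof -
  obtain y where "f y \<noteq> \<infinity>"
    using assms(1) unfolding proper_def by auto
  moreover have "f x + ereal (u \<bullet> (y - x)) \<le> f y"
    using assms(2) by (simp add: subdifferential_def)
  ultimately have "f x \<noteq> \<infinity>"
    by auto
  then show ?thesis
    using that assms(1) unfolding proper_def by (cases "f x") auto
qed

lemma subdifferential_monotone:
  assumes "proper f" "u \<in> subdifferential f x" "v \<in> subdifferential f y"
  shows "0 \<le> (u - v) \<bullet> (x - y)"
proof -
  obtain a b where ab: "f x = ereal a" "f y = ereal b"
    using assms subgradient_finite by metis
  have "f x + ereal (u \<bullet> (y - x)) \<le> f y" "f y + ereal (v \<bullet> (x - y)) \<le> f x"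
    using assms by (auto simp: subdifferential_def)
  then show ?thesis
    using ab by (simp add: inner_diff)
qed

text \<open>Strong convexity on the segment from \<open>x\<close> to \<open>y\<close> is compared
  with the subgradient inequality at an interior point. Dividing by \<open>t\<close> leaves an error
  of order \<open>t\<close>, which vanishes in the limit.\<close>

lemma strongly_convex_subgradient_ineq:
  assumes sc: "strongly_convex \<mu> f" and u: "u \<in> subdifferential f x"
    and a: "f x = ereal a" and b: "f y = ereal b"
  shows "a + u \<bullet> (y - x) + \<mu> / 2 * (norm (y - x))\<^sup>2 \<le> b"
proof (rule le_of_le_add_scaled)
  fix t :: real
  assume t: "0 < t" "t < 1"
  define w where "w = t *\<^sub>R y + (1 - t) *\<^sub>R x"
  have wx: "w - x = t *\<^sub>R (y - x)"
    by (simp add: w_def algebra_simps)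
  have le: "f w + ereal (\<mu> / 2 * t * (1 - t) * (norm (y - x))\<^sup>2) \<le> ereal (t * b + (1 - t) * a)"
    using sc[unfolded strongly_convex_def, rule_format, of t y x] t by (simp add: a b w_def)
  have "f x + ereal (u \<bullet> (w - x)) \<le> f w"
    using u by (simp add: subdifferential_def)
  then have "ereal (a + t * (u \<bullet> (y - x))) \<le> f w"
    by (simp add: wx a)
  then have "a + t * (u \<bullet> (y - x)) + \<mu> / 2 * t * (1 - t) * (norm (y - x))\<^sup>2 \<le> t * b + (1 - t) * a"
    using le by (cases "f w") auto
  then have "t * (a + u \<bullet> (y - x) + \<mu> / 2 * (norm (y - x))\<^sup>2)
      \<le> t * (b + t * (\<mu> / 2 * (norm (y - x))\<^sup>2))"
    by (simp add: algebra_simps diff_divide_distrib)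
  then show "a + u \<bullet> (y - x) + \<mu> / 2 * (norm (y - x))\<^sup>2 \<le> b + t * (\<mu> / 2 * (norm (y - x))\<^sup>2)"
    using t by simp
qed

text \<open>Adding the previous inequality to itself with \<open>x\<close> and \<open>y\<close>
  exchanged cancels the function values and doubles the quadratic gain.\<close>

lemma strongly_convex_strongly_monotone:
  assumes "proper f" "strongly_convex \<mu> f"
    and u: "u \<in> subdifferential f x" and v: "v \<in> subdifferential f y"
  shows "\<mu> * (norm (x - y))\<^sup>2 \<le> (u - v) \<bullet> (x - y)"
proof -
  obtain a b where ab: "f x = ereal a" "f y = ereal b"
    using assms subgradient_finite by metis
  show ?thesis
    using strongly_convex_subgradient_ineq[OF assms(2) u ab]
      strongly_convex_subgradient_ineq[OF assms(2) v ab(2,1)]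
    by (simp add: inner_diff norm_minus_commute)
qed

section \<open>Lipschitz gradients\<close>

lemma gderiv_along_line:
  assumes "GDERIV \<phi> (x + t *\<^sub>R d) :> e"
  shows "((\<lambda>s. \<phi> (x + s *\<^sub>R d)) has_real_derivative e \<bullet> d) (at t)"
proof -
  have "((\<lambda>s. x + s *\<^sub>R d) has_derivative (\<lambda>h. h *\<^sub>R d)) (at t)"
    by (auto intro!: derivative_eq_intros)
  moreover have "(\<phi> has_derivative (\<lambda>h. h \<bullet> e)) (at (x + t *\<^sub>R d))"
    using assms by (simp add: gderiv_def)
  ultimately have "(\<phi> \<circ> (\<lambda>s. x + s *\<^sub>R d) has_derivative (\<lambda>h. h \<bullet> e) \<circ> (\<lambda>h. h *\<^sub>R d)) (at t)"
    by (rule diff_chain_at)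
  then show ?thesis
    by (simp add: has_field_derivative_def o_def inner_commute mult_commute_abs)
qed

lemma descent_lemma:
  fixes \<phi> :: "'a::real_inner \<Rightarrow> real"
  assumes G: "\<And>x. GDERIV \<phi> x :> G x" and L: "L-lipschitz_on UNIV G"
  shows "\<phi> (x + d) \<le> \<phi> x + G x \<bullet> d + L / 2 * (norm d)\<^sup>2"
proof -
  \<comment> \<open>Up to a constant, \<open>h\<close> is \<phi> along the segment minus its
    quadratic upper model at \<open>x\<close>. The Lipschitz bound makes its derivative nonpositive
    on [0, 1].\<close>
  define h where "h t = \<phi> (x + t *\<^sub>R d) - t * (G x \<bullet> d) - L / 2 * t\<^sup>2 * (norm d)\<^sup>2" for t
  have "h 1 \<le> h 0"
  proof (rule DERIV_nonpos_imp_nonincreasing[of 0 1 h])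
    show "(0::real) \<le> 1" by simp
    fix t :: real
    assume t: "0 \<le> t" "t \<le> 1"
    have "(h has_real_derivative G (x + t *\<^sub>R d) \<bullet> d - G x \<bullet> d - L * t * (norm d)\<^sup>2) (at t)"
      unfolding h_def
      by (rule derivative_eq_intros gderiv_along_line[OF G] refl | simp)+
    moreover have "(G (x + t *\<^sub>R d) - G x) \<bullet> d \<le> norm (G (x + t *\<^sub>R d) - G x) * norm d"
      by (rule norm_cauchy_schwarz)
    moreover have "\<dots> \<le> (L * norm (t *\<^sub>R d)) * norm d"
      using lipschitz_onD[OF L, of "x + t *\<^sub>R d" x]
      by (intro mult_right_mono) (auto simp: dist_norm)
    moreover have "(L * norm (t *\<^sub>R d)) * norm d = L * t * (norm d)\<^sup>2"
      using t by (simp add: power2_eq_square)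
    ultimately show "\<exists>y. DERIV h t :> y \<and> y \<le> 0"
      by (metis diff_le_0_iff_le inner_diff_left order_trans)
  qed
  then show ?thesis
    by (simp add: h_def)
qed

lemma subgradient_eq_gradient:
  fixes \<phi> :: "'a::real_inner \<Rightarrow> real"
  assumes G: "GDERIV \<phi> x :> e" and u: "\<And>y. \<phi> x + u \<bullet> (y - x) \<le> \<phi> y"
  shows "e = u"
proof -
  \<comment> \<open>The tilted function is minimal at \<open>x\<close>, so its derivative in every
    direction is zero. In this direction that derivative is
    \<open>- (d \<bullet> d)\<close>.\<close>
  define d where "d = u - e"
  have "((\<lambda>s. \<phi> (x + s *\<^sub>R d) - s * (u \<bullet> d)) has_real_derivative e \<bullet> d - u \<bullet> d) (at 0)"
    by (rule derivative_eq_intros gderiv_along_line[of \<phi> x 0 d e] refl | simp add: G)+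
  then have "e \<bullet> d - u \<bullet> d = 0"
  proof (rule DERIV_local_min[of _ _ _ 1])
    show "\<forall>y. \<bar>0 - y\<bar> < 1 \<longrightarrow>
        \<phi> (x + 0 *\<^sub>R d) - 0 * (u \<bullet> d) \<le> \<phi> (x + y *\<^sub>R d) - y * (u \<bullet> d)"
      using u[of "x + _ *\<^sub>R d"] by (simp add: algebra_simps)
  qed simp
  then have "d \<bullet> d = 0"
    by (simp add: d_def inner_diff inner_commute)
  then show ?thesis
    by (simp add: d_def)
qed

text \<open>One gradient step of length \<open>\<beta>\<close> from \<open>y\<close> for the tilted function \<open>\<phi> - \<langle>u, \<cdot>\<rangle>\<close>, which is
  minimal at \<open>x\<close>.\<close>

lemma lipschitz_gradient_subgradient_ineq:
  fixes \<phi> :: "'a::real_inner \<Rightarrow> real"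
  assumes G: "\<And>x. GDERIV \<phi> x :> G x" and L: "(1 / \<beta>)-lipschitz_on UNIV G" and \<beta>: "\<beta> > 0"
    and u: "\<And>y. \<phi> x + u \<bullet> (y - x) \<le> \<phi> y"
  shows "\<phi> x + u \<bullet> (y - x) + \<beta> / 2 * (norm (u - G y))\<^sup>2 \<le> \<phi> y"
proof -
  define d where "d = \<beta> *\<^sub>R (u - G y)"
  have "\<phi> (y + d) \<le> \<phi> y + G y \<bullet> d + 1 / \<beta> / 2 * (norm d)\<^sup>2"
    by (rule descent_lemma[OF G L])
  moreover have "1 / \<beta> / 2 * (norm d)\<^sup>2 = \<beta> / 2 * (norm (u - G y))\<^sup>2"
    using \<beta> by (simp add: d_def power_mult_distrib power2_eq_square)
  moreover have "(u - G y) \<bullet> d = \<beta> * (norm (u - G y))\<^sup>2"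
    by (simp add: d_def power2_norm_eq_inner)
  moreover have "\<phi> x + u \<bullet> (y - x) + u \<bullet> d \<le> \<phi> (y + d)"
    using u[of "y + d"] by (simp add: algebra_simps)
  ultimately show ?thesis
    by (simp add: inner_diff_left)
qed

text \<open>Baillon-Haddad: subgradients coincide with gradients here, and the improved subgradient
  inequality is added in both directions.\<close>

lemma lipschitz_gradient_cocoercive:
  assumes lip: "lipschitz_gradient (1 / \<beta>) f" and \<beta>: "\<beta> > 0"
    and u: "u \<in> subdifferential f x" and v: "v \<in> subdifferential f y"
  shows "\<beta> * (norm (u - v))\<^sup>2 \<le> (u - v) \<bullet> (x - y)"
proof -
  define \<phi> where "\<phi> = (\<lambda>y. real_of_ereal (f y))"
  obtain G where fin: "\<And>x. \<bar>f x\<bar> \<noteq> \<infinity>" and G: "\<And>x. GDERIV \<phi> x :> G x"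
    and L: "(1 / \<beta>)-lipschitz_on UNIV G"
    using lip unfolding lipschitz_gradient_def \<phi>_def by auto
  have sub: "\<phi> x + u \<bullet> (y - x) \<le> \<phi> y" if "u \<in> subdifferential f x" for x y u
  proof -
    have "f x + ereal (u \<bullet> (y - x)) \<le> f y"
      using that by (simp add: subdifferential_def)
    then show ?thesis
      using fin[of x] fin[of y] unfolding \<phi>_def by (cases "f x"; cases "f y") auto
  qed
  have eq: "G x = u" "G y = v"
    using subgradient_eq_gradient[OF G sub] u v by blast+
  show ?thesis
    using lipschitz_gradient_subgradient_ineq[OF G L \<beta> sub[OF u], of y]
      lipschitz_gradient_subgradient_ineq[OF G L \<beta> sub[OF v], of x]
    by (simp add: eq inner_diff norm_minus_commute)
qed

lemma S_reg_le_inner: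
  assumes "proper f" "strongly_convex \<mu> f" "0 \<le> \<beta>"
    and "\<beta> > 0 \<Longrightarrow> lipschitz_gradient (1 / \<beta>) f"
    and u: "u \<in> subdifferential f x" and v: "v \<in> subdifferential f y"
  shows "2 * S_reg \<mu> \<beta> x u y v \<le> (u - v) \<bullet> (x - y)"
proof -
  have "\<beta> * (norm (u - v))\<^sup>2 \<le> (u - v) \<bullet> (x - y)"
    \<comment> \<open>For \<open>\<beta> = 0\<close> the left side is zero and monotonicity
      suffices; otherwise cocoercivity applies.\<close>
    using subdifferential_monotone[OF assms(1) u v] lipschitz_gradient_cocoercive[OF _ _ u v] assms(3,4)
    by (cases "\<beta> = 0") auto
  then show ?thesis
    using strongly_convex_strongly_monotone[OF assms(1,2) u v] by (simp add: S_reg_def)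
qed

section \<open>The proximal operator\<close>

text \<open>An affine minorant replaces the Hahn-Banach argument that would otherwise bound the proximal
  objective from below.\<close>

lemma prox_objective_bounded_below:
  fixes u :: "'a::real_inner"
  assumes "\<gamma> > 0"
  shows "u \<bullet> (x - x0) - \<gamma> / 2 * (norm u)\<^sup>2 \<le> u \<bullet> (y - x0) + 1 / (2 * \<gamma>) * (norm (y - x))\<^sup>2"
proof -
  \<comment> \<open>Completing the square.\<close>
  have "0 \<le> 1 / (2 * \<gamma>) * (norm (\<gamma> *\<^sub>R u + (y - x)))\<^sup>2"
    using assms by simp
  also have "\<dots> = \<gamma> / 2 * (norm u)\<^sup>2 + u \<bullet> (y - x) + 1 / (2 * \<gamma>) * (norm (y - x))\<^sup>2"
    using assms unfolding power2_norm_eq_inner inner_add_left inner_add_right inner_scaleR_left inner_scaleR_right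
    by (simp add: field_simps inner_commute power2_eq_square)
  finally show ?thesis
    by (simp add: inner_diff_right)
qed

text \<open>The negative term quantifies the strict convexity of the squared norm; it is what makes
  minimizing sequences Cauchy.\<close>

lemma norm_midpoint_sq:
  fixes a b :: "'a::real_inner"
  shows "(norm ((1 / 2) *\<^sub>R a + (1 / 2) *\<^sub>R b))\<^sup>2
    = (norm a)\<^sup>2 / 2 + (norm b)\<^sup>2 / 2 - (norm (a - b))\<^sup>2 / 4"
  by (simp add: power2_norm_eq_inner inner_add inner_diff inner_commute algebra_simps diff_divide_distrib
      add_divide_distrib)

text \<open>Minimisation of \<open>f + \<parallel>\<cdot> - x\<parallel>\<^sup>2 / (2 * \<gamma>)\<close>, phrased over the epigraph of \<open>f\<close> in order to stay
  within the reals.\<close>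

lemma epi_minimizer_exists:
  fixes C :: "('a::{real_inner, complete_space} \<times> real) set"
  assumes C: "closed C" "convex C" "C \<noteq> {}" and \<gamma>: "\<gamma> > 0"
    and below: "\<And>y r. (y, r) \<in> C \<Longrightarrow> c + u \<bullet> (y - x0) \<le> r"
  obtains p s where "(p, s) \<in> C"
    "\<And>y r. (y, r) \<in> C \<Longrightarrow>
      s + 1 / (2 * \<gamma>) * (norm (p - x))\<^sup>2 \<le> r + 1 / (2 * \<gamma>) * (norm (y - x))\<^sup>2"
proof -
  define q where "q = (\<lambda>w::'a \<times> real. snd w + 1 / (2 * \<gamma>) * (norm (fst w - x))\<^sup>2)"
  define m where "m = Inf (q ` C)"
  have bdd: "bdd_below (q ` C)"
  proof (rule bdd_belowI2)
    fix w assume "w \<in> C"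
    then show "c + (u \<bullet> (x - x0) - \<gamma> / 2 * (norm u)\<^sup>2) \<le> q w"
      using below[of "fst w" "snd w"] prox_objective_bounded_below[OF \<gamma>, of u x x0 "fst w"]
      by (simp add: q_def)
  qed
  have m_le: "m \<le> q w" if "w \<in> C" for w
    unfolding m_def using bdd that by (rule cINF_lower)
  have "\<exists>w\<in>C. q w < m + 1 / real (Suc n)" for n
  proof -
    have "m < m + 1 / real (Suc n)"
      by simp
    then show ?thesis
      using cINF_less_iff[OF C(3) bdd] unfolding m_def by blast
  qed
  then obtain w where wC: "\<And>n. w n \<in> C" and wq: "\<And>n. q (w n) < m + 1 / real (Suc n)"
    by metis
  \<comment> \<open>The midpoint of two near-minimizers stays in \<open>C\<close>, so its objective
    is at least \<open>m\<close>. The midpoint gain of the quadratic then bounds the distance of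
    their first components.\<close>
  have mid: "(norm (fst a - fst b))\<^sup>2 \<le> 4 * \<gamma> * ((q a - m) + (q b - m))"
    if "a \<in> C" "b \<in> C" for a b
  proof -
    have "(1 / 2) *\<^sub>R a + (1 / 2) *\<^sub>R b \<in> C"
      using that by (intro convexD[OF C(2)]) auto
    then have "m \<le> q ((1 / 2) *\<^sub>R a + (1 / 2) *\<^sub>R b)"
      by (rule m_le)
    also have "\<dots> = (snd a + snd b) / 2
        + 1 / (2 * \<gamma>) * (norm ((1 / 2) *\<^sub>R (fst a - x) + (1 / 2) *\<^sub>R (fst b - x)))\<^sup>2"
    proof -
      have "(1 / 2) *\<^sub>R (fst a - x) + (1 / 2) *\<^sub>R (fst b - x) = fst ((1 / 2) *\<^sub>R a + (1 / 2) *\<^sub>R b) - x"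
        by (simp add: algebra_simps flip: scaleR_add_left)
      then show ?thesis
        by (simp add: q_def)
    qed
    also have "\<dots> = (q a + q b) / 2 - 1 / (8 * \<gamma>) * (norm (fst a - fst b))\<^sup>2"
      unfolding norm_midpoint_sq by (simp add: q_def add_divide_distrib distrib_left right_diff_distrib)
    finally show ?thesis
      using \<gamma> by (simp add: field_simps)
  qed
  have "Cauchy (\<lambda>n. fst (w n))"
  proof (rule metric_CauchyI)
    fix e :: real
    assume e: "0 < e"
    \<comment> \<open>This tolerance makes \<open>4 * \<gamma>\<close> times two gaps equal to the
      square of \<open>e\<close> in \<open>mid\<close>.\<close>
    then have "e\<^sup>2 / (8 * \<gamma>) > 0"
      using \<gamma> by simp
    then obtain N where N: "1 / real (Suc N) < e\<^sup>2 / (8 * \<gamma>)"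
      using nat_approx_posE by blast
    have "dist (fst (w i)) (fst (w j)) < e" if ij: "i \<ge> N" "j \<ge> N" for i j
    proof -
      have small: "q (w i) - m < e\<^sup>2 / (8 * \<gamma>)" if "i \<ge> N" for i
      proof -
        have "1 / real (Suc i) \<le> 1 / real (Suc N)"
          using that by (simp add: frac_le)
        then show ?thesis
          using wq[of i] N by linarith
      qed
      have "(norm (fst (w i) - fst (w j)))\<^sup>2 \<le> 4 * \<gamma> * ((q (w i) - m) + (q (w j) - m))"
        using mid wC by blast
      also have "\<dots> < 4 * \<gamma> * (e\<^sup>2 / (8 * \<gamma>) + e\<^sup>2 / (8 * \<gamma>))"
        using small ij \<gamma> by (intro mult_strict_left_mono add_strict_mono) auto
      also have "\<dots> = e\<^sup>2"
        using \<gamma> by simp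
      finally show ?thesis
        using e by (simp add: dist_norm power_less_imp_less_base)
    qed
    then show "\<exists>M. \<forall>i\<ge>M. \<forall>j\<ge>M. dist (fst (w i)) (fst (w j)) < e"
      by blast
  qed
  then obtain p where p: "(\<lambda>n. fst (w n)) \<longlonglongrightarrow> p"
    using Cauchy_convergent convergent_def by blast
  have ql: "(\<lambda>n. q (w n)) \<longlonglongrightarrow> m"
  proof (rule tendsto_sandwich[OF _ _ tendsto_const])
    show "\<forall>\<^sub>F n in sequentially. m \<le> q (w n)"
      using m_le wC by simp
    show "\<forall>\<^sub>F n in sequentially. q (w n) \<le> m + 1 / real (Suc n)"
      using wq less_imp_le by (intro always_eventually) blast
    show "(\<lambda>n. m + 1 / real (Suc n)) \<longlonglongrightarrow> m"
      using tendsto_add[OF tendsto_const[of m] LIMSEQ_Suc[OF lim_1_over_n]] by simp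
  qed
  \<comment> \<open>The Cauchy argument controls only first components. The heights converge because
    they are \<open>q\<close> minus the quadratic term, and \<open>s\<close> is their limit.\<close>
  define s where "s = m - 1 / (2 * \<gamma>) * (norm (p - x))\<^sup>2"
  have "(\<lambda>n. q (w n) - 1 / (2 * \<gamma>) * (norm (fst (w n) - x))\<^sup>2) \<longlonglongrightarrow> s"
    unfolding s_def by (intro tendsto_intros ql p)
  then have "(\<lambda>n. snd (w n)) \<longlonglongrightarrow> s"
    by (simp add: q_def)
  then have "(\<lambda>n. (fst (w n), snd (w n))) \<longlonglongrightarrow> (p, s)"
    by (intro tendsto_Pair p)
  then have "w \<longlonglongrightarrow> (p, s)"
    by simp
  with C(1) wC have "(p, s) \<in> C"
    by (rule closed_sequentially)
  moreover have "s + 1 / (2 * \<gamma>) * (norm (p - x))\<^sup>2 \<le> r + 1 / (2 * \<gamma>) * (norm (y - x))\<^sup>2"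
    if "(y, r) \<in> C" for y r
    using m_le[OF that] by (simp add: s_def q_def)
  ultimately show ?thesis
    using that by blast
qed

lemma prox_minimizes:
  fixes f :: "'a::{real_inner, complete_space} \<Rightarrow> ereal"
  assumes f: "closed_proper_convex f" and u: "u \<in> subdifferential f x0" and \<gamma>: "\<gamma> > 0"
  shows "f (prox \<gamma> f x) + ereal (1 / (2 * \<gamma>) * (norm (prox \<gamma> f x - x))\<^sup>2)
    \<le> f y + ereal (1 / (2 * \<gamma>) * (norm (y - x))\<^sup>2)"
proof -
  define F where "F = (\<lambda>y. f y + ereal (1 / (2 * \<gamma>) * (norm (y - x))\<^sup>2))"
  have pr: "proper f"
    using f by (simp add: closed_proper_convex_def)
  obtain c where c: "f x0 = ereal c"
    using subgradient_finite[OF pr u] .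
  have "(x0, c) \<in> epi f"
    by (simp add: epi_def c)
  then have ne: "epi f \<noteq> {}"
    by blast
  have below: "c + u \<bullet> (y - x0) \<le> r" if "(y, r) \<in> epi f" for y r
  proof -
    have "ereal c + ereal (u \<bullet> (y - x0)) \<le> f y"
      using u c by (simp add: subdifferential_def)
    also have "\<dots> \<le> ereal r"
      using that by (simp add: epi_def)
    finally show ?thesis
      by simp
  qed
  obtain p s where ps: "(p, s) \<in> epi f"
    and min: "\<And>y r. (y, r) \<in> epi f \<Longrightarrow>
      s + 1 / (2 * \<gamma>) * (norm (p - x))\<^sup>2 \<le> r + 1 / (2 * \<gamma>) * (norm (y - x))\<^sup>2"
    using epi_minimizer_exists[OF _ _ ne \<gamma> below, of x] f
    unfolding closed_proper_convex_def by blast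
  have "F p \<le> F y" for y
  proof (cases "f y")
    case (real r)
    have "F p \<le> ereal s + ereal (1 / (2 * \<gamma>) * (norm (p - x))\<^sup>2)"
      unfolding F_def using ps by (intro add_right_mono) (simp add: epi_def)
    also have "\<dots> \<le> F y"
      using min[of y r] real by (simp add: F_def epi_def)
    finally show ?thesis .
  qed (use pr in \<open>auto simp: F_def proper_def\<close>)
  \<comment> \<open>\<open>prox\<close> is a Hilbert choice, so exhibiting one minimizer makes the
    chosen point a minimizer as well.\<close>
  then have "is_arg_min F (\<lambda>_. True) p"
    by (simp add: is_arg_min_def not_less)
  then have "is_arg_min F (\<lambda>_. True) (prox \<gamma> f x)"
    unfolding prox_def arg_min_def F_def by (rule someI)
  then show ?thesis
    by (simp add: is_arg_min_def F_def not_less)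
qed

text \<open>First-order optimality of the proximal problem: the minimizer is compared with points of
  a segment leaving it. This is what turns the selected vectors of the algorithm into
  subgradients.\<close>

lemma prox_subgradient:
  fixes f :: "'a::{real_inner, complete_space} \<Rightarrow> ereal"
  assumes f: "closed_proper_convex f" and u: "u \<in> subdifferential f x0" and \<gamma>: "\<gamma> > 0"
  shows "(1 / \<gamma>) *\<^sub>R (x - prox \<gamma> f x) \<in> subdifferential f (prox \<gamma> f x)"
proof -
  define p where "p = prox \<gamma> f x"
  note min = prox_minimizes[OF assms, of x, folded p_def]
  have pr: "proper f"
    using f by (simp add: closed_proper_convex_def)
  obtain c where c: "f x0 = ereal c"
    using subgradient_finite[OF pr u] .
  \<comment> \<open>Comparison with \<open>x0\<close>, where \<open>f\<close> is finite, places the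
    minimizer in the effective domain.\<close>
  have "f p \<noteq> \<infinity>"
    using min[of x0] c by auto
  then obtain a where a: "f p = ereal a"
    using pr unfolding proper_def by (cases "f p") auto
  have "f p + ereal ((1 / \<gamma>) *\<^sub>R (x - p) \<bullet> (y - p)) \<le> f y" for y
  proof (cases "f y")
    case (real b)
    have "a + (1 / \<gamma>) * ((x - p) \<bullet> (y - p)) \<le> b"
    proof (rule le_of_le_add_scaled)
      fix t :: real
      assume t: "0 < t" "t < 1"
      define w where "w = (1 - t) *\<^sub>R p + t *\<^sub>R y"
      have "(1 - t) *\<^sub>R (p, a) + t *\<^sub>R (y, b) \<in> epi f"
        using f t a real by (intro convexD) (auto simp: closed_proper_convex_def epi_def)
      then have fw: "f w \<le> ereal ((1 - t) * a + t * b)"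
        by (simp add: epi_def w_def)
      have "ereal (a + 1 / (2 * \<gamma>) * (norm (p - x))\<^sup>2) \<le> f w + ereal (1 / (2 * \<gamma>) * (norm (w - x))\<^sup>2)"
        using min[of w] a by simp
      also have "\<dots> \<le> ereal ((1 - t) * a + t * b) + ereal (1 / (2 * \<gamma>) * (norm (w - x))\<^sup>2)"
        using fw by (rule add_right_mono)
      finally have le: "a + 1 / (2 * \<gamma>) * (norm (p - x))\<^sup>2
          \<le> (1 - t) * a + t * b + 1 / (2 * \<gamma>) * (norm (w - x))\<^sup>2"
        by simp
      have wx: "w - x = (p - x) + t *\<^sub>R (y - p)"
        by (simp add: w_def algebra_simps)
      have "(norm (w - x))\<^sup>2 = (norm (p - x))\<^sup>2 - 2 * t * ((x - p) \<bullet> (y - p)) + t\<^sup>2 * (norm (y - p))\<^sup>2"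
        unfolding wx using dot_norm[of "p - x" "t *\<^sub>R (y - p)"]
          inner_minus_left[of "x - p" "y - p"] by (simp add: power_mult_distrib)
      \<comment> \<open>The quadratic changes by a term linear in \<open>t\<close> and one of second
        order; only the linear one survives division by \<open>t\<close> and the limit.\<close>
      then have "1 / (2 * \<gamma>) * (norm (w - x))\<^sup>2 = 1 / (2 * \<gamma>) * (norm (p - x))\<^sup>2
          - t * ((1 / \<gamma>) * ((x - p) \<bullet> (y - p))) + t * (t * ((norm (y - p))\<^sup>2 / (2 * \<gamma>)))"
        using \<gamma> by (simp add: field_simps power2_eq_square[of t])
      then have "t * (a + (1 / \<gamma>) * ((x - p) \<bullet> (y - p)))
          \<le> t * (b + t * ((norm (y - p))\<^sup>2 / (2 * \<gamma>)))"
        using le unfolding distrib_left left_diff_distrib by linarith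
      then show "a + (1 / \<gamma>) * ((x - p) \<bullet> (y - p)) \<le> b + t * ((norm (y - p))\<^sup>2 / (2 * \<gamma>))"
        using t by simp
    qed
    then show ?thesis
      using a real by simp
  qed (use pr in \<open>auto simp: proper_def\<close>)
  then show ?thesis
    by (simp add: subdifferential_def p_def)
qed

lemma norm_scaled_diff_sq:
  fixes a b :: "'a::real_inner"
  shows "(norm (2 *\<^sub>R a - b))\<^sup>2 = (norm b)\<^sup>2 - 4 * ((b - a) \<bullet> a)"
  by (simp add: power2_norm_eq_inner inner_diff inner_commute)

text \<open>Monotonicity at the two prox points, scaled by \<gamma>, says that prox is firmly
  nonexpansive; reflecting such a map gives a nonexpansive one.\<close>

lemma reflector_nonexpansive:
  fixes f :: "'a::{real_inner, complete_space} \<Rightarrow> ereal"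
  assumes f: "closed_proper_convex f" and u: "u \<in> subdifferential f x0" and \<gamma>: "\<gamma> > 0"
  shows "norm (reflector \<gamma> f x - reflector \<gamma> f y) \<le> norm (x - y)"
proof -
  define p q where "p = prox \<gamma> f x" and "q = prox \<gamma> f y"
  have "0 \<le> ((1 / \<gamma>) *\<^sub>R (x - p) - (1 / \<gamma>) *\<^sub>R (y - q)) \<bullet> (p - q)"
    unfolding p_def q_def
    using f prox_subgradient[OF assms]
    by (intro subdifferential_monotone) (auto simp: closed_proper_convex_def)
  also have "\<dots> = (1 / \<gamma>) * (((x - y) - (p - q)) \<bullet> (p - q))"
    by (simp add: algebra_simps flip: scaleR_diff_right)
  finally have *: "0 \<le> ((x - y) - (p - q)) \<bullet> (p - q)"
    using \<gamma> by (simp add: zero_le_divide_iff)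
  have "reflector \<gamma> f x - reflector \<gamma> f y = 2 *\<^sub>R (p - q) - (x - y)"
    by (simp add: reflector_def p_def q_def scaleR_diff_right)
  then have "(norm (reflector \<gamma> f x - reflector \<gamma> f y))\<^sup>2
      = (norm (x - y))\<^sup>2 - 4 * (((x - y) - (p - q)) \<bullet> (p - q))"
    by (simp only: norm_scaled_diff_sq)
  then show ?thesis
    using * by (intro power2_le_imp_le[OF _ norm_ge_zero]) simp
qed

section \<open>Rates from summability, and averaging\<close>

lemma Min_summable_smallo:
  fixes a :: "nat \<Rightarrow> real"
  assumes nonneg: "\<And>i. 0 \<le> a i" and sum: "summable a"
  shows "(\<lambda>k. MIN i\<in>{0..k}. a i) \<in> o(\<lambda>k. 1 / real (k + 1))"
proof (rule smalloI_tendsto)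
  define s where "s n = (\<Sum>i<n. a i)" for n
  have s: "s \<longlonglongrightarrow> suminf a"
    unfolding s_def by (rule summable_LIMSEQ[OF sum])
  have Min: "0 \<le> (MIN i\<in>{0..k}. a i)" for k
    using nonneg by simp
  \<comment> \<open>The window from \<open>k div 2\<close> to \<open>k\<close> holds at least half
    of the \<open>k + 1\<close> indices, and its sum is a difference of partial sums that both tend
    to \<open>suminf a\<close>.\<close>
  have bound: "real (k + 1) * (MIN i\<in>{0..k}. a i) \<le> 2 * (s (Suc k) - s (k div 2))" for k
  proof -
    have "real (k + 1) * (MIN i\<in>{0..k}. a i) \<le> real (2 * card {k div 2..<Suc k}) * (MIN i\<in>{0..k}. a i)"
      by (intro mult_right_mono Min) (simp del: of_nat_mult)
    also have "\<dots> = 2 * (\<Sum>j\<in>{k div 2..<Suc k}. MIN i\<in>{0..k}. a i)"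
      by simp
    also have "\<dots> \<le> 2 * (\<Sum>j\<in>{k div 2..<Suc k}. a j)"
      by (intro mult_left_mono sum_mono Min_le) auto
    also have "(\<Sum>j\<in>{k div 2..<Suc k}. a j) = s (Suc k) - s (k div 2)"
      using sum_diff_nat_ivl[of 0 "k div 2" "Suc k" a] by (simp add: s_def atLeast0LessThan)
    finally show ?thesis .
  qed
  have "(\<lambda>k. 2 * (s (Suc k) - s (k div 2))) \<longlonglongrightarrow> 2 * (suminf a - suminf a)"
  proof (intro tendsto_intros)
    show "(\<lambda>k. s (Suc k)) \<longlonglongrightarrow> suminf a"
      using s by (rule LIMSEQ_Suc)
    show "(\<lambda>k. s (k div 2)) \<longlonglongrightarrow> suminf a"
      using s by (rule filterlim_compose) (rule filterlim_at_top_div_const_nat, simp)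
  qed
  then have "(\<lambda>k. 2 * (s (Suc k) - s (k div 2))) \<longlonglongrightarrow> 0"
    by simp
  then have "(\<lambda>k. real (k + 1) * (MIN i\<in>{0..k}. a i)) \<longlonglongrightarrow> 0"
    by (rule tendsto_sandwich[OF always_eventually always_eventually tendsto_const, rotated 2])
      (intro allI bound mult_nonneg_nonneg[OF of_nat_0_le_iff Min])+
  then show "(\<lambda>k. (MIN i\<in>{0..k}. a i) / (1 / real (k + 1))) \<longlonglongrightarrow> 0"
    by (simp add: mult.commute)
qed simp

lemma summable_telescope_le:
  fixes a D :: "nat \<Rightarrow> real"
  assumes nonneg: "\<And>i. 0 \<le> a i" "\<And>i. 0 \<le> D i" and le: "\<And>i. a i \<le> D i - D (Suc i)"
  shows "summable a" and "suminf a \<le> D 0"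
proof -
  have "(\<Sum>i<n. a i) \<le> D 0 - D n" for n
    using le by (induction n) (auto, smt (verit))
  then have bound: "(\<Sum>i<n. a i) \<le> D 0" for n
    using nonneg(2) by (smt (verit))
  then show "summable a"
    by (intro summableI_nonneg_bounded nonneg)
  then show "suminf a \<le> D 0"
    by (rule suminf_le_const) (rule bound)
qed

text \<open>A nonincreasing sequence is its own running minimum.\<close>

lemma decseq_summable_smallo:
  fixes a :: "nat \<Rightarrow> real"
  assumes "decseq a" "\<And>i. 0 \<le> a i" "summable a"
  shows "a \<in> o(\<lambda>k. 1 / real (k + 1))"
proof -
  have "(MIN i\<in>{0..k}. a i) = a k" for k
    by (rule Min_eqI) (auto intro: decseqD[OF assms(1)])
  then show ?thesis
    using Min_summable_smallo[OF assms(2,3)] by simp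
qed

lemma smallo_sqrt:
  fixes a b :: "nat \<Rightarrow> real"
  assumes "(\<lambda>k. (a k)\<^sup>2) \<in> o(\<lambda>k. b k)" "\<And>k. 0 < b k"
  shows "a \<in> o(\<lambda>k. sqrt (b k))"
proof (rule smalloI_tendsto)
  have "(\<lambda>k. sqrt ((a k)\<^sup>2 / b k)) \<longlonglongrightarrow> sqrt 0"
    by (intro tendsto_real_sqrt smalloD_tendsto[OF assms(1)])
  then have "(\<lambda>k. \<bar>a k / sqrt (b k)\<bar>) \<longlonglongrightarrow> 0"
    using assms(2) by (simp add: real_sqrt_divide abs_divide less_imp_le)
  then show "(\<lambda>k. a k / sqrt (b k)) \<longlonglongrightarrow> 0"
    by (simp only: tendsto_rabs_zero_iff)
  show "\<forall>\<^sub>F k in sequentially. sqrt (b k) \<noteq> 0"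
    using assms(2) by (simp add: less_imp_neq[THEN not_sym])
qed

text \<open>Jensen's inequality for the squared norm, obtained as nonnegativity of the weighted
  variance about the mean.\<close>

lemma norm_weighted_mean_diff_sq:
  fixes a :: "'i \<Rightarrow> 'a::real_inner"
  assumes w: "\<And>i. i \<in> I \<Longrightarrow> 0 \<le> w i" and W: "W = sum w I" "W > 0"
  shows "W * (norm ((1 / W) *\<^sub>R (\<Sum>i\<in>I. w i *\<^sub>R a i) - c))\<^sup>2 \<le> (\<Sum>i\<in>I. w i * (norm (a i - c))\<^sup>2)"
proof -
  define m where "m = (1 / W) *\<^sub>R (\<Sum>i\<in>I. w i *\<^sub>R a i) - c"
  have m: "(\<Sum>i\<in>I. w i *\<^sub>R (a i - c)) = W *\<^sub>R m"
    using W by (simp add: m_def scaleR_diff_right sum_subtractf flip: scaleR_left.sum)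
  have "0 \<le> (\<Sum>i\<in>I. w i * (norm ((a i - c) - m))\<^sup>2)"
    using w by (intro sum_nonneg mult_nonneg_nonneg) auto
  also have "\<dots> = (\<Sum>i\<in>I. w i * (norm (a i - c))\<^sup>2 - 2 * ((w i *\<^sub>R (a i - c)) \<bullet> m) + w i * (norm m)\<^sup>2)"
    by (intro sum.cong refl)
      (simp add: power2_norm_eq_inner inner_diff inner_commute algebra_simps)
  also have "\<dots> = (\<Sum>i\<in>I. w i * (norm (a i - c))\<^sup>2) - 2 * ((\<Sum>i\<in>I. w i *\<^sub>R (a i - c)) \<bullet> m) + W * (norm m)\<^sup>2"
    by (simp add: sum.distrib sum_subtractf W inner_sum_left sum_distrib_left sum_distrib_right)
  also have "\<dots> = (\<Sum>i\<in>I. w i * (norm (a i - c))\<^sup>2) - W * (norm m)\<^sup>2"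
    unfolding m by (simp add: power2_norm_eq_inner)
  finally show ?thesis
    by (simp add: m_def)
qed

lemma S_reg_nonneg: "0 \<le> \<mu> \<Longrightarrow> 0 \<le> S_reg \<mu> \<beta> x u y v"
  by (simp add: S_reg_def le_max_iff_disj)

lemma S_reg_weighted_mean:
  fixes x u :: "'i \<Rightarrow> 'a::real_inner"
  assumes w: "\<And>i. i \<in> I \<Longrightarrow> 0 \<le> w i" and W: "W = sum w I" "W > 0"
    and nonneg: "0 \<le> \<mu>" "0 \<le> \<beta>"
  shows "W * S_reg \<mu> \<beta> ((1 / W) *\<^sub>R (\<Sum>i\<in>I. w i *\<^sub>R x i)) ((1 / W) *\<^sub>R (\<Sum>i\<in>I. w i *\<^sub>R u i)) y v
    \<le> (\<Sum>i\<in>I. w i * S_reg \<mu> \<beta> (x i) (u i) y v)"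
proof -
  \<comment> \<open>Treats both entries of the maximum at once: it is used with \<mu> and the
    points, then with \<beta> and the subgradients.\<close>
  have part: "W * (\<nu> / 2 * (norm ((1 / W) *\<^sub>R (\<Sum>i\<in>I. w i *\<^sub>R a i) - c))\<^sup>2)
      \<le> (\<Sum>i\<in>I. w i * S_reg \<mu> \<beta> (x i) (u i) y v)"
    if "0 \<le> \<nu>" and le: "\<And>i. i \<in> I \<Longrightarrow> \<nu> / 2 * (norm (a i - c))\<^sup>2 \<le> S_reg \<mu> \<beta> (x i) (u i) y v"
    for \<nu> a and c :: 'a
  proof -
    have "\<nu> / 2 * (W * (norm ((1 / W) *\<^sub>R (\<Sum>i\<in>I. w i *\<^sub>R a i) - c))\<^sup>2)
        \<le> \<nu> / 2 * (\<Sum>i\<in>I. w i * (norm (a i - c))\<^sup>2)"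
      using that(1) by (intro mult_left_mono norm_weighted_mean_diff_sq w W) auto
    also have "\<dots> = (\<Sum>i\<in>I. w i * (\<nu> / 2 * (norm (a i - c))\<^sup>2))"
      by (simp add: sum_distrib_left mult_ac)
    also have "\<dots> \<le> (\<Sum>i\<in>I. w i * S_reg \<mu> \<beta> (x i) (u i) y v)"
      using w le by (intro sum_mono mult_left_mono) auto
    finally show ?thesis
      by (simp add: mult_ac)
  qed
  show ?thesis
    unfolding S_reg_def[of \<mu> \<beta> "(1 / W) *\<^sub>R _"] max_mult_distrib_left
    using part[OF nonneg(1), of x y] part[OF nonneg(2), of u v] W(2)
    by (simp add: S_reg_def)
qed
section \<open>The relaxed Peaceman-Rachford iteration\<close>

text \<open>To be read with \<open>a\<close>, \<open>b\<close>, \<open>c\<close> as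
  \<open>x\<^sub>g k\<close>, \<open>x\<^sub>f k\<close>, \<open>x'\<close> and \<open>w\<close> as
  \<open>z k - z'\<close>. The left factors are then \<gamma> times the subgradient differences of
  \<open>f\<close> and \<open>g\<close>.\<close>

lemma prs_inner_identity:
  fixes a b c w :: "'a::real_inner"
  shows "(2 *\<^sub>R a - b - w - c) \<bullet> (b - c) + (w - a + c) \<bullet> (a - c)
    = (a - b) \<bullet> w - (norm (a - b))\<^sup>2"
  by (simp add: power2_norm_eq_inner inner_add inner_diff inner_commute algebra_simps)

text \<open>One relaxed step moves by \<open>- ((2 * l) *\<^sub>R d)\<close>, where \<open>d\<close>
  is half of the fixed-point residual and \<open>w\<close> the offset from the fixed point.\<close>

lemma relaxation_norm_identity:
  fixes w d :: "'a::real_inner"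
  assumes "l > 0"
  shows "(norm w)\<^sup>2 - (norm (w - (2 * l) *\<^sub>R d))\<^sup>2 + (1 - 1 / l) * (norm (- ((2 * l) *\<^sub>R d)))\<^sup>2
    = 4 * l * (d \<bullet> w - (norm d)\<^sup>2)"
proof -
  have "(norm (w - (2 * l) *\<^sub>R d))\<^sup>2 = (norm w)\<^sup>2 - 4 * l * (d \<bullet> w) + 4 * l\<^sup>2 * (norm d)\<^sup>2"
    using dot_norm_neg[of w "(2 * l) *\<^sub>R d"]
    by (simp add: power_mult_distrib inner_commute[of w d])
  moreover have "(1 - 1 / l) * (norm (- ((2 * l) *\<^sub>R d)))\<^sup>2 = 4 * l\<^sup>2 * (norm d)\<^sup>2 - 4 * l * (norm d)\<^sup>2"
    using assms by (simp add: power_mult_distrib field_simps power2_eq_square[of l])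
  ultimately show ?thesis
    by (simp add: right_diff_distrib)
qed

theorem theorem1:
  fixes f g :: "'a::{real_inner, complete_space} \<Rightarrow> ereal"
    and \<gamma> \<mu>\<^sub>f \<mu>\<^sub>g \<beta>\<^sub>f \<beta>\<^sub>g :: real
    and lam \<Lambda> S\<^sub>f S\<^sub>g :: "nat \<Rightarrow> real"
    and z x\<^sub>f x\<^sub>g u\<^sub>f u\<^sub>g :: "nat \<Rightarrow> 'a"
    and z' x' v\<^sub>f v\<^sub>g :: 'a
  assumes f: "closed_proper_convex f"
    and g: "closed_proper_convex g"
    and zero: "\<exists>x. 0 \<in> subdifferential f x + subdifferential g x"
    and \<gamma>: "\<gamma> > 0"
    and nonneg: "\<mu>\<^sub>f \<ge> 0" "\<mu>\<^sub>g \<ge> 0" "\<beta>\<^sub>f \<ge> 0" "\<beta>\<^sub>g \<ge> 0"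
    and strong: "strongly_convex \<mu>\<^sub>f f" "strongly_convex \<mu>\<^sub>g g"
    and smooth: "\<beta>\<^sub>f > 0 \<Longrightarrow> lipschitz_gradient (1 / \<beta>\<^sub>f) f"
                "\<beta>\<^sub>g > 0 \<Longrightarrow> lipschitz_gradient (1 / \<beta>\<^sub>g) g"
    and lam: "\<And>j. 0 < lam j \<and> lam j \<le> 1"
    and z: "\<And>k. z (Suc k) = (1 - lam k) *\<^sub>R z k + lam k *\<^sub>R T_PRS \<gamma> f g (z k)"
    and x\<^sub>g: "\<And>k. x\<^sub>g k = prox \<gamma> g (z k)"
    and x\<^sub>f: "\<And>k. x\<^sub>f k = prox \<gamma> f (2 *\<^sub>R x\<^sub>g k - z k)"
    and z': "T_PRS \<gamma> f g z' = z'"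
    and x': "x' = prox \<gamma> g z'"
    and u\<^sub>g: "\<And>k. u\<^sub>g k = (1 / \<gamma>) *\<^sub>R (z k - x\<^sub>g k)"
    and u\<^sub>f: "\<And>k. u\<^sub>f k = (1 / \<gamma>) *\<^sub>R (2 *\<^sub>R x\<^sub>g k - z k - x\<^sub>f k)"
    and v\<^sub>g: "v\<^sub>g = (1 / \<gamma>) *\<^sub>R (z' - x')"
    and v\<^sub>f: "v\<^sub>f = - (1 / \<gamma>) *\<^sub>R (z' - x')"
    and S\<^sub>f: "\<And>k. S\<^sub>f k = S_reg \<mu>\<^sub>f \<beta>\<^sub>f (x\<^sub>f k) (u\<^sub>f k) x' v\<^sub>f"
    and S\<^sub>g: "\<And>k. S\<^sub>g k = S_reg \<mu>\<^sub>g \<beta>\<^sub>g (x\<^sub>g k) (u\<^sub>g k) x' v\<^sub>g"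
    and \<Lambda>: "\<And>k. \<Lambda> k = (\<Sum>i\<le>k. lam i)"
  shows
    "(\<forall>k. 8 * \<gamma> * lam k * (S\<^sub>f k + S\<^sub>g k)
        \<le> (norm (z k - z'))\<^sup>2 - (norm (z (Suc k) - z'))\<^sup>2
          + (1 - 1 / lam k) * (norm (z (Suc k) - z k))\<^sup>2) \<and>
     summable (\<lambda>i. lam i * (S\<^sub>f i + S\<^sub>g i)) \<and>
     8 * \<gamma> * (\<Sum>i. lam i * (S\<^sub>f i + S\<^sub>g i)) \<le> (norm (z 0 - z'))\<^sup>2 \<and>
     ((INF j. lam j) > 0 \<longrightarrow>
        (\<lambda>k. MIN i\<in>{0..k}. S\<^sub>f i) \<in> o(\<lambda>k. 1 / real (k + 1)) \<and>
        (\<lambda>k. MIN i\<in>{0..k}. S\<^sub>g i) \<in> o(\<lambda>k. 1 / real (k + 1))) \<and>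
     (\<forall>k. S_reg \<mu>\<^sub>f \<beta>\<^sub>f
            ((1 / \<Lambda> k) *\<^sub>R (\<Sum>i\<le>k. lam i *\<^sub>R x\<^sub>f i))
            ((1 / \<Lambda> k) *\<^sub>R (\<Sum>i\<le>k. lam i *\<^sub>R u\<^sub>f i)) x' v\<^sub>f
        + S_reg \<mu>\<^sub>g \<beta>\<^sub>g
            ((1 / \<Lambda> k) *\<^sub>R (\<Sum>i\<le>k. lam i *\<^sub>R x\<^sub>g i))
            ((1 / \<Lambda> k) *\<^sub>R (\<Sum>i\<le>k. lam i *\<^sub>R u\<^sub>g i)) x' v\<^sub>g
        \<le> (norm (z 0 - z'))\<^sup>2 / (8 * \<gamma> * \<Lambda> k)) \<and>
     ((INF j. lam j * (1 - lam j)) > 0 \<longrightarrow>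
        (\<lambda>k. S\<^sub>f k + S\<^sub>g k) \<in> o(\<lambda>k. 1 / sqrt (real (k + 1))))"
proof -

  \<comment> \<open>Subgradients at the iterates and at the fixed point\<close>
  have pf: "proper f" and pg: "proper g"
    using f g by (auto simp: closed_proper_convex_def)
  \<comment> \<open>The zero of the sum supplies a subgradient of each function, hence the affine
    minorants behind the existence of prox points.\<close>
  obtain x0 u0 v0 where u0: "u0 \<in> subdifferential f x0" and v0: "v0 \<in> subdifferential g x0"
    using zero by (auto simp: set_plus_def)
  note subf = prox_subgradient[OF f u0 \<gamma>] and subg = prox_subgradient[OF g v0 \<gamma>]

  \<comment> \<open>The fixed-point equation forces the second prox to return \<open>x'\<close> too,
    so that \<open>v\<^sub>f\<close> is a subgradient of \<open>f\<close> at
    \<open>x'\<close>.\<close>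
  have "2 *\<^sub>R prox \<gamma> f (2 *\<^sub>R x' - z') - (2 *\<^sub>R x' - z') = z'"
    using z' by (simp add: T_PRS_def reflector_def x')
  then have "2 *\<^sub>R prox \<gamma> f (2 *\<^sub>R x' - z') = 2 *\<^sub>R x'"
    by (simp add: algebra_simps)
  then have fixf: "prox \<gamma> f (2 *\<^sub>R x' - z') = x'"
    by simp

  have uf: "u\<^sub>f k \<in> subdifferential f (x\<^sub>f k)" for k
    using subf[of "2 *\<^sub>R x\<^sub>g k - z k"] by (simp add: u\<^sub>f x\<^sub>f)
  have ug: "u\<^sub>g k \<in> subdifferential g (x\<^sub>g k)" for k
    using subg[of "z k"] by (simp add: u\<^sub>g x\<^sub>g)
  have "v\<^sub>f = (1 / \<gamma>) *\<^sub>R (2 *\<^sub>R x' - z' - x')"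
    by (simp add: v\<^sub>f scaleR_2 flip: scaleR_minus_right)
  then have vf: "v\<^sub>f \<in> subdifferential f x'"
    using subf[of "2 *\<^sub>R x' - z'"] by (simp add: fixf)
  have vg: "v\<^sub>g \<in> subdifferential g x'"
    using subg[of z'] by (simp add: v\<^sub>g x')

  have Sf0: "0 \<le> S\<^sub>f k" and Sg0: "0 \<le> S\<^sub>g k" for k
    using nonneg by (simp_all add: S\<^sub>f S\<^sub>g S_reg_nonneg)
  have S0: "0 \<le> lam k * (S\<^sub>f k + S\<^sub>g k)" for k
    using Sf0 Sg0 lam by (simp add: less_imp_le)

  \<comment> \<open>Half of the residual \<open>z k - T_PRS \<gamma> f g (z k)\<close>; the whole
    recursion is expressed through it.\<close>
  define d where "d k = x\<^sub>g k - x\<^sub>f k" for k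
  have Tz: "T_PRS \<gamma> f g (z k) = z k - 2 *\<^sub>R d k" for k
    by (simp add: T_PRS_def reflector_def x\<^sub>f x\<^sub>g d_def algebra_simps)
  have zd: "z (Suc k) = z k - (2 * lam k) *\<^sub>R d k" for k
    by (simp add: z Tz algebra_simps)

  \<comment> \<open>The one-step inequality\<close>
  have key: "2 * \<gamma> * (S\<^sub>f k + S\<^sub>g k) \<le> d k \<bullet> (z k - z') - (norm (d k))\<^sup>2" for k
  proof -
    have "2 * S\<^sub>f k \<le> (u\<^sub>f k - v\<^sub>f) \<bullet> (x\<^sub>f k - x')"
      unfolding S\<^sub>f by (rule S_reg_le_inner[OF pf strong(1) nonneg(3) _ uf vf]) (rule smooth(1))
    moreover have "2 * S\<^sub>g k \<le> (u\<^sub>g k - v\<^sub>g) \<bullet> (x\<^sub>g k - x')"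
      unfolding S\<^sub>g by (rule S_reg_le_inner[OF pg strong(2) nonneg(4) _ ug vg]) (rule smooth(2))
    ultimately have "\<gamma> * (2 * S\<^sub>f k + 2 * S\<^sub>g k)
        \<le> \<gamma> * ((u\<^sub>f k - v\<^sub>f) \<bullet> (x\<^sub>f k - x') + (u\<^sub>g k - v\<^sub>g) \<bullet> (x\<^sub>g k - x'))"
      using \<gamma> by (intro mult_left_mono add_mono) auto
    also have "\<dots> = (\<gamma> *\<^sub>R (u\<^sub>f k - v\<^sub>f)) \<bullet> (x\<^sub>f k - x') + (\<gamma> *\<^sub>R (u\<^sub>g k - v\<^sub>g)) \<bullet> (x\<^sub>g k - x')"
      by (simp add: distrib_left)
    also have "\<gamma> *\<^sub>R (u\<^sub>f k - v\<^sub>f) = 2 *\<^sub>R x\<^sub>g k - x\<^sub>f k - (z k - z') - x'"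
      using \<gamma> by (simp add: u\<^sub>f v\<^sub>f scaleR_diff_right[of \<gamma>] scaleR_add_right[of \<gamma>])
    also have "\<gamma> *\<^sub>R (u\<^sub>g k - v\<^sub>g) = z k - z' - x\<^sub>g k + x'"
      using \<gamma> by (simp add: u\<^sub>g v\<^sub>g scaleR_diff_right[of \<gamma>])
    finally show ?thesis
      unfolding prs_inner_identity d_def by (simp add: algebra_simps)
  qed

  define D where "D k = (norm (z k - z'))\<^sup>2" for k
  have step: "D k - D (Suc k) + (1 - 1 / lam k) * (norm (z (Suc k) - z k))\<^sup>2
      = 4 * lam k * (d k \<bullet> (z k - z') - (norm (d k))\<^sup>2)" for k
    using relaxation_norm_identity[of "lam k" "z k - z'" "d k"] lam[of k]
    by (simp add: D_def zd algebra_simps)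
  have main: "8 * \<gamma> * lam k * (S\<^sub>f k + S\<^sub>g k)
      \<le> D k - D (Suc k) + (1 - 1 / lam k) * (norm (z (Suc k) - z k))\<^sup>2" for k
  proof -
    have "4 * lam k * (2 * \<gamma> * (S\<^sub>f k + S\<^sub>g k)) \<le> 4 * lam k * (d k \<bullet> (z k - z') - (norm (d k))\<^sup>2)"
      using lam[of k] by (intro mult_left_mono key) auto
    then show ?thesis
      unfolding step by (simp add: mult_ac)
  qed
  \<comment> \<open>The relaxation term is nonpositive because \<open>lam k\<close> lies in (0, 1].
    It is dropped for the telescoping bound and kept for the nonergodic rate.\<close>
  have fpr: "(1 - 1 / lam k) * (norm (z (Suc k) - z k))\<^sup>2 = - (4 * (lam k * (1 - lam k)) * (norm (d k))\<^sup>2)" for k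
    using lam[of k] by (simp add: zd power_mult_distrib field_simps power2_eq_square)
  have fpr0: "0 \<le> 4 * (lam k * (1 - lam k)) * (norm (d k))\<^sup>2" for k
    using lam[of k] by simp
  have S_le: "8 * \<gamma> * (lam k * (S\<^sub>f k + S\<^sub>g k)) \<le> D k - D (Suc k)" for k
    using main[of k] fpr[of k] fpr0[of k] by (simp add: mult_ac)
  have S0': "0 \<le> 8 * \<gamma> * (lam k * (S\<^sub>f k + S\<^sub>g k))" for k
    using S0 \<gamma> by simp
  have D0: "0 \<le> D k" for k
    by (simp add: D_def)

  \<comment> \<open>Summability by telescoping\<close>
  have "summable (\<lambda>k. 8 * \<gamma> * (lam k * (S\<^sub>f k + S\<^sub>g k)))"
    using S0' D0 S_le by (rule summable_telescope_le(1))
  then have summ: "summable (\<lambda>k. lam k * (S\<^sub>f k + S\<^sub>g k))"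
    using \<gamma> by (simp add: summable_cmult_iff)
  have "(\<Sum>k. 8 * \<gamma> * (lam k * (S\<^sub>f k + S\<^sub>g k))) \<le> D 0"
    using S0' D0 S_le by (rule summable_telescope_le(2))
  then have sum_le: "8 * \<gamma> * (\<Sum>k. lam k * (S\<^sub>f k + S\<^sub>g k)) \<le> D 0"
    using suminf_mult[OF summ] by simp

  \<comment> \<open>Best-iterate rate\<close>
  have best: "(\<lambda>k. MIN i\<in>{0..k}. S\<^sub>f i) \<in> o(\<lambda>k. 1 / real (k + 1)) \<and>
      (\<lambda>k. MIN i\<in>{0..k}. S\<^sub>g i) \<in> o(\<lambda>k. 1 / real (k + 1))"
    if pos: "(INF j. lam j) > 0"
  proof -
    define c where "c = (INF j. lam j)"
    \<comment> \<open>A real infimum bounds its family only when the family is bounded below; the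
      bound here is 0.\<close>
    have c: "c \<le> lam j" for j
      unfolding c_def
      by (rule cINF_lower[OF bdd_belowI2[of _ 0]]) (use lam in \<open>simp_all add: less_imp_le\<close>)
    have "c * (S\<^sub>f k + S\<^sub>g k) \<le> lam k * (S\<^sub>f k + S\<^sub>g k)" for k
      using c Sf0 Sg0 by (intro mult_right_mono) auto
    moreover have "0 \<le> c * S\<^sub>f k" "0 \<le> c * S\<^sub>g k" for k
      using pos Sf0 Sg0 unfolding c_def by simp_all
    ultimately have "norm (c * S\<^sub>f k) \<le> lam k * (S\<^sub>f k + S\<^sub>g k)"
      "norm (c * S\<^sub>g k) \<le> lam k * (S\<^sub>f k + S\<^sub>g k)" for k
      unfolding real_norm_def distrib_left[of c] by (smt (verit))+
    then have "summable (\<lambda>k. c * S\<^sub>f k)" "summable (\<lambda>k. c * S\<^sub>g k)"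
      by - (rule summable_comparison_test'[OF summ, of 0], blast)+
    then have "summable S\<^sub>f" "summable S\<^sub>g"
      using pos by (simp_all add: summable_cmult_iff c_def)
    then show ?thesis
      using Min_summable_smallo Sf0 Sg0 by blast
  qed

  \<comment> \<open>Ergodic rate\<close>
  have ergodic: "S_reg \<mu>\<^sub>f \<beta>\<^sub>f ((1 / \<Lambda> k) *\<^sub>R (\<Sum>i\<le>k. lam i *\<^sub>R x\<^sub>f i))
        ((1 / \<Lambda> k) *\<^sub>R (\<Sum>i\<le>k. lam i *\<^sub>R u\<^sub>f i)) x' v\<^sub>f
      + S_reg \<mu>\<^sub>g \<beta>\<^sub>g ((1 / \<Lambda> k) *\<^sub>R (\<Sum>i\<le>k. lam i *\<^sub>R x\<^sub>g i))
        ((1 / \<Lambda> k) *\<^sub>R (\<Sum>i\<le>k. lam i *\<^sub>R u\<^sub>g i)) x' v\<^sub>g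
      \<le> D 0 / (8 * \<gamma> * \<Lambda> k)" (is "?F + ?G \<le> _") for k
  proof -
    have pos: "\<Lambda> k > 0"
      unfolding \<Lambda> using lam by (intro sum_pos) auto
    have "\<Lambda> k * ?F \<le> (\<Sum>i\<le>k. lam i * S\<^sub>f i)" "\<Lambda> k * ?G \<le> (\<Sum>i\<le>k. lam i * S\<^sub>g i)"
      unfolding S\<^sub>f S\<^sub>g
      by (intro S_reg_weighted_mean \<Lambda> pos nonneg less_imp_le conjunct1[OF lam])+
    then have "\<Lambda> k * (?F + ?G) \<le> (\<Sum>i\<le>k. lam i * (S\<^sub>f i + S\<^sub>g i))"
      by (simp add: distrib_left sum.distrib)
    \<comment> \<open>All terms are nonnegative, so the partial sum is controlled by the series
      bound already obtained.\<close>
    also have "\<dots> \<le> (\<Sum>i. lam i * (S\<^sub>f i + S\<^sub>g i))"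
      using S0 by (intro sum_le_suminf[OF summ]) auto
    finally have "8 * \<gamma> * (\<Lambda> k * (?F + ?G)) \<le> 8 * \<gamma> * (\<Sum>i. lam i * (S\<^sub>f i + S\<^sub>g i))"
      using \<gamma> by (intro mult_left_mono) auto
    also note sum_le
    also have "8 * \<gamma> * (\<Lambda> k * (?F + ?G)) = (?F + ?G) * (8 * \<gamma> * \<Lambda> k)"
      by (simp only: mult_ac)
    finally have "(?F + ?G) * (8 * \<gamma> * \<Lambda> k) \<le> D 0" .
    moreover have "8 * \<gamma> * \<Lambda> k > 0"
      using \<gamma> pos by simp
    ultimately show ?thesis
      by (simp only: pos_le_divide_eq)
  qed

  \<comment> \<open>Nonergodic rate\<close>
  have nonergodic: "(\<lambda>k. S\<^sub>f k + S\<^sub>g k) \<in> o(\<lambda>k. 1 / sqrt (real (k + 1)))"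
    if pos: "(INF j. lam j * (1 - lam j)) > 0"
  proof -
    define c where "c = (INF j. lam j * (1 - lam j))"
    have c: "c \<le> lam j * (1 - lam j)" for j
      unfolding c_def
      by (rule cINF_lower[OF bdd_belowI2[of _ 0]]) (use lam in \<open>simp_all add: less_imp_le\<close>)
    \<comment> \<open>Now the \<open>S\<close> terms are discarded from the main inequality and the
      relaxation term is retained.\<close>
    have "4 * c * (norm (d k))\<^sup>2 \<le> D k - D (Suc k)" for k
    proof -
      have "4 * c * (norm (d k))\<^sup>2 \<le> 4 * (lam k * (1 - lam k)) * (norm (d k))\<^sup>2"
        using c by (intro mult_right_mono) auto
      then show ?thesis
        using main[of k] fpr[of k] S0'[of k] by (simp add: mult_ac)
    qed
    then have "summable (\<lambda>k. 4 * c * (norm (d k))\<^sup>2)"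
      using pos D0 by (intro summable_telescope_le(1)[of _ D]) (auto simp: c_def)
    then have summ_d: "summable (\<lambda>k. (norm (d k))\<^sup>2)"
      using pos by (simp add: summable_cmult_iff c_def)
    have dec: "norm (d (Suc k)) \<le> norm (d k)" for k
    proof -
      \<comment> \<open>The new residual is split at \<open>T_PRS \<gamma> f g (z k)\<close>. By
        nonexpansiveness the two parts are at most \<open>2 * (1 - lam k)\<close> and
        \<open>2 * lam k\<close> times \<open>norm (d k)\<close>, and these weights add up to
        2.\<close>
      have "2 *\<^sub>R d (Suc k) = (z (Suc k) - T_PRS \<gamma> f g (z k))
          + (T_PRS \<gamma> f g (z k) - T_PRS \<gamma> f g (z (Suc k)))"
        by (simp add: Tz)
      then have "norm (2 *\<^sub>R d (Suc k)) \<le> norm (z (Suc k) - T_PRS \<gamma> f g (z k))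
          + norm (T_PRS \<gamma> f g (z k) - T_PRS \<gamma> f g (z (Suc k)))"
        by (metis norm_triangle_ineq)
      also have "norm (T_PRS \<gamma> f g (z k) - T_PRS \<gamma> f g (z (Suc k))) \<le> norm (z k - z (Suc k))"
        unfolding T_PRS_def o_def
        using reflector_nonexpansive[OF f u0 \<gamma>] reflector_nonexpansive[OF g v0 \<gamma>]
        by (rule order_trans)
      also have "z k - z (Suc k) = (2 * lam k) *\<^sub>R d k"
        by (simp add: zd)
      also have "z (Suc k) - T_PRS \<gamma> f g (z k) = (2 * (1 - lam k)) *\<^sub>R d k"
        by (simp add: zd Tz algebra_simps)
      also have "norm ((2 * (1 - lam k)) *\<^sub>R d k) + norm ((2 * lam k) *\<^sub>R d k) = 2 * norm (d k)"
        using lam[of k] by (simp add: left_diff_distrib)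
      finally show ?thesis
        by simp
    qed
    have "(\<lambda>k. (norm (d k))\<^sup>2) \<in> o(\<lambda>k. 1 / real (k + 1))"
      using dec by (intro decseq_summable_smallo summ_d decseq_SucI power_mono) auto
    then have "(\<lambda>k. norm (d k)) \<in> o(\<lambda>k. sqrt (1 / real (k + 1)))"
      by (rule smallo_sqrt) simp
    moreover have "(\<lambda>k. S\<^sub>f k + S\<^sub>g k) \<in> O(\<lambda>k. norm (d k))"
    proof (intro bigoI always_eventually allI)
      fix k
      \<comment> \<open>Fejer monotonicity bounds \<open>norm (z k - z')\<close> uniformly, so
        Cauchy-Schwarz in \<open>key\<close> leaves a constant multiple of
        \<open>norm (d k)\<close>.\<close>
      have "decseq D"
        using S_le S0' by (intro decseq_SucI) (smt (verit))
      then have "D k \<le> D 0"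
        by (simp add: decseqD)
      then have "norm (z k - z') \<le> norm (z 0 - z')"
        by (simp add: D_def power_mono_iff)
      then have "d k \<bullet> (z k - z') \<le> norm (d k) * norm (z 0 - z')"
        by (meson mult_left_mono norm_cauchy_schwarz norm_ge_zero order_trans)
      then have "2 * \<gamma> * (S\<^sub>f k + S\<^sub>g k) \<le> norm (d k) * norm (z 0 - z')"
        using key[of k] by (smt (verit) zero_le_power2)
      then show "norm (S\<^sub>f k + S\<^sub>g k) \<le> norm (z 0 - z') / (2 * \<gamma>) * norm (norm (d k))"
        using \<gamma> Sf0[of k] Sg0[of k] by (simp add: pos_le_divide_eq mult_ac)
    qed
    ultimately have "(\<lambda>k. S\<^sub>f k + S\<^sub>g k) \<in> o(\<lambda>k. sqrt (1 / real (k + 1)))"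
      by (rule landau_o.big_small_trans[rotated])
    then show ?thesis
      by (simp add: real_sqrt_divide)
  qed

  show ?thesis
    using main summ sum_le best ergodic nonergodic unfolding D_def by blast
qed

end
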